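(* Let $M\in\mathcal{M}_n(\mathbb{R})$ be a matrix such that $\|M\|_2\leq 1$ and write its singular value decomposition $M=PD(\sigma)Q^T$, where $P,Q$ are $n\times n$ real orthogonal matrices and $\sigma=(\sigma_1,\dots,\sigma_n)\in[0,1]^n$ is the vector of singular values of $M$. Let $B=(B_1,\dots,B_n)$ be a vector of $n$ independent random variables taking values in $\{-1,1\}$ and satisfying $\mathbb{E}[B_i]=\sigma_i$ for each $i$. Define the random matrix $\tilde K=\frac12\big(I_n-PD(B)Q^T\big)$ (which is always a DPP kernel). If $X$ is a random subset of $[n]$ which, conditionally on $B$, is a DPP with kernel $\tilde K$, then $X$ is a DPP with kernel $K=\frac12(I_n-M)$.
   Context: $[n]=\{1,\dots,n\}$; $\mathcal{M}_n(\mathbb{R})$ is the set of real $n\times n$ matrices; $I_n$ is the identity matrix; $D(x)$ is the diagonal matrix with diagonal entries $x_1,\dots,x_n$; $\|M\|_2$ is the spectral norm. For $S\subset[n]$, $K_S$ is the principal submatrix of $K$ with rows and columns indexed by $S$, with $\det(K_\emptyset)=1$. The determinantal measure with kernel $K$ is the unique signed measure $\mu$ on the power set $\mathcal{P}([n])$ such that $\mu(\{X\in\mathcal{P}([n]): S\subset X\})=\det(K_S)$ for all $S\subset[n]$. $K$ is called a DPP kernel if this $\mu$ is a probability measure; a random subset $X$ of $[n]$ with law $\mu$ is then called a DPP with kernel $K$. Kernels are not assumed symmetric. *)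

theory Defs
  imports "HOL-Probability.Probability"
begin

text \<open>
  The ground set \<open>[n]\<close> is rendered as an arbitrary finite type \<open>'n\<close>, so that real \<open>n \<times> n\<close>
  matrices are elements of \<^typ>\<open>real^'n^'n\<close> and random subsets take values in \<^typ>\<open>'n set\<close>.
\<close>

definition diag_mat_of :: "real^'n \<Rightarrow> real^'n^'n" where
  "diag_mat_of x = (\<chi> i j. if i = j then x $ i else 0)"

text \<open>
  \<open>principal_minor K S\<close> is the determinant of the principal submatrix \<open>K\<^sub>S\<close>. A submatrix indexed by
  a set rather than by a type is not an element of a matrix type, so the Leibniz formula that defines
  \<^const>\<open>det\<close> is taken over the index set \<open>S\<close>.  Lemma \<open>principal_minor_eq_det\<close> relates it to
  \<^const>\<open>det\<close>.
\<close>

definition principal_minor :: "real^'n^'n \<Rightarrow> 'n set \<Rightarrow> real" where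
  "principal_minor K S =
     (\<Sum>p | p permutes S. of_int (sign p) * (\<Prod>i\<in>S. K $ i $ p i))"

lemma principal_minor_empty [simp]: "principal_minor K {} = 1"
  by (simp add: principal_minor_def)

lemma principal_minor_eq_det:
  fixes K :: "real^'n^'n" and f :: "'m::finite \<Rightarrow> 'n"
  assumes "inj f" and "range f = S"
  shows "principal_minor K S = det (\<chi> i j. K $ f i $ f j)"
proof -
  have bij: "bij_betw f UNIV S" "bij_betw (inv_into UNIV f) S UNIV"
    using assms bij_betw_inv_into[of f UNIV S] by (auto intro: bij_betw_imageI)
  have "det (\<chi> i j. K $ f i $ f j) =
      (\<Sum>p | p permutes UNIV. of_int (sign p) * (\<Prod>i\<in>UNIV. K $ f i $ f (p i)))"
    by (simp add: det_def)
  also have "\<dots> = (\<Sum>p | p permutes S. of_int (sign p) * (\<Prod>i\<in>S. K $ i $ p i))"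
  proof (rule sum.reindex_bij_witness[where j = "map_permutation UNIV f"
        and i = "map_permutation S (inv_into UNIV f)"])
    fix p :: "'m \<Rightarrow> 'm" assume "p \<in> {p. p permutes UNIV}"
    then have p: "p permutes UNIV" by simp
    show "map_permutation S (inv_into UNIV f) (map_permutation UNIV f p) = p"
      by (rule map_permutation_compose_inv[OF bij(1) p]) (use assms(1) in simp)
    show "map_permutation UNIV f p \<in> {p. p permutes S}"
      using map_permutation_permutes[OF bij(1) p] by simp
    have "(\<Prod>i\<in>S. K $ i $ map_permutation UNIV f p i) = (\<Prod>i\<in>UNIV. K $ f i $ f (p i))"
      unfolding assms(2)[symmetric] prod.reindex[OF assms(1)]
      using assms(1) by (simp add: map_permutation_apply)
    then show "of_int (sign (map_permutation UNIV f p)) *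
        (\<Prod>i\<in>S. K $ i $ map_permutation UNIV f p i) =
        of_int (sign p) * (\<Prod>i\<in>UNIV. K $ f i $ f (p i))"
      using sign_map_permutation[OF assms(1) p] by simp
  next
    fix q assume "q \<in> {p. p permutes S}"
    then have q: "q permutes S" by simp
    show "map_permutation UNIV f (map_permutation S (inv_into UNIV f) q) = q"
      by (rule map_permutation_compose_inv[OF bij(2) q]) (use assms(2) in \<open>auto intro: f_inv_into_f\<close>)
    show "map_permutation S (inv_into UNIV f) q \<in> {p. p permutes UNIV}"
      using map_permutation_permutes[OF bij(2) q] by simp
  qed
  finally show ?thesis by (simp add: principal_minor_def)
qed

text \<open>A signed measure on the finite set \<open>\<P>([n])\<close>: countable additivity reduces to additivity.\<close>

definition signed_measure :: "('n::finite set set \<Rightarrow> real) \<Rightarrow> bool" where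
  "signed_measure \<mu> \<longleftrightarrow>
     \<mu> {} = 0 \<and> (\<forall>\<A> \<B>. \<A> \<inter> \<B> = {} \<longrightarrow> \<mu> (\<A> \<union> \<B>) = \<mu> \<A> + \<mu> \<B>)"

definition determinantal_measure :: "real^'n^'n \<Rightarrow> 'n set set \<Rightarrow> real" where
  "determinantal_measure K =
     (THE \<mu>. signed_measure \<mu> \<and> (\<forall>S. \<mu> {X. S \<subseteq> X} = principal_minor K S))"

lemma signed_measure_eq_sum:
  assumes "signed_measure \<mu>"
  shows "\<mu> \<A> = (\<Sum>X\<in>\<A>. \<mu> {X})"
proof -
  have "finite \<A>" by simp
  then show ?thesis
  proof (induction \<A> rule: finite_induct)
    case empty
    then show ?case using assms by (simp add: signed_measure_def)
  next
    case (insert X \<A>)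
    have "\<mu> ({X} \<union> \<A>) = \<mu> {X} + \<mu> \<A>"
      using assms insert.hyps unfolding signed_measure_def by blast
    then show ?case using insert by simp
  qed
qed

lemma signed_measure_sum: "signed_measure (\<lambda>\<A>. sum m \<A>)"
  by (simp add: signed_measure_def sum.union_disjoint)

lemma ex1_signed_measure_upsets:
  fixes h :: "'n::finite set \<Rightarrow> real"
  shows "\<exists>!\<mu>. signed_measure \<mu> \<and> (\<forall>S. \<mu> {X. S \<subseteq> X} = h S)"
proof (rule ex_ex1I)
  define f where "f S = (\<Sum>T\<in>Pow S. (-1) ^ card T * h (- T))" for S
  have f: "h (- S) = (\<Sum>T\<in>Pow S. (-1) ^ card T * f T)" for S
    by (rule inclusion_exclusion_symmetric[of f "\<lambda>S. h (- S)"]) (auto simp: f_def)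
  define m where "m X = (-1) ^ card (- X) * f (- X)" for X
  have "sum m {X. S \<subseteq> X} = h S" for S
  proof -
    have "sum m {X. S \<subseteq> X} = (\<Sum>T\<in>Pow (- S). (-1) ^ card T * f T)"
      by (rule sum.reindex_bij_witness[where i = uminus and j = uminus]) (auto simp: m_def)
    then show ?thesis using f[of "- S"] by simp
  qed
  then show "\<exists>\<mu>. signed_measure \<mu> \<and> (\<forall>S. \<mu> {X. S \<subseteq> X} = h S)"
    by (intro exI[of _ "sum m"]) (simp add: signed_measure_sum)
next
  fix \<mu> \<nu> :: "'n set set \<Rightarrow> real"
  assume mu: "signed_measure \<mu> \<and> (\<forall>S. \<mu> {X. S \<subseteq> X} = h S)"
    and nu: "signed_measure \<nu> \<and> (\<forall>S. \<nu> {X. S \<subseteq> X} = h S)"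
  have "\<mu> {X} = \<nu> {X}" for X
  proof (induction "card (- X)" arbitrary: X rule: less_induct)
    case less
    have up: "{Y. X \<subseteq> Y} = insert X {Y. X \<subset> Y}" by auto
    have "\<mu> {Y} = \<nu> {Y}" if "X \<subset> Y" for Y
      using that by (intro less psubset_card_mono) auto
    then have "sum (\<lambda>Y. \<mu> {Y}) {Y. X \<subset> Y} = sum (\<lambda>Y. \<nu> {Y}) {Y. X \<subset> Y}" by simp
    moreover have "\<mu> {Y. X \<subseteq> Y} = \<nu> {Y. X \<subseteq> Y}" using mu nu by simp
    ultimately show ?case
      using signed_measure_eq_sum[of \<mu> "{Y. X \<subseteq> Y}"] signed_measure_eq_sum[of \<nu> "{Y. X \<subseteq> Y}"] mu nu
      by (simp add: up)
  qed
  note singletons = this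
  show "\<mu> = \<nu>"
  proof
    fix \<A>
    have "\<mu> \<A> = (\<Sum>X\<in>\<A>. \<mu> {X})" using mu by (intro signed_measure_eq_sum) auto
    also have "\<dots> = (\<Sum>X\<in>\<A>. \<nu> {X})" by (intro sum.cong singletons refl)
    also have "\<dots> = \<nu> \<A>" using nu by (intro signed_measure_eq_sum[symmetric]) auto
    finally show "\<mu> \<A> = \<nu> \<A>" .
  qed
qed

lemma determinantal_measure:
  "signed_measure (determinantal_measure K)"
  "determinantal_measure K {X. S \<subseteq> X} = principal_minor K S"
proof -
  have *: "signed_measure (determinantal_measure K) \<and>
      (\<forall>S. determinantal_measure K {X. S \<subseteq> X} = principal_minor K S)"
    unfolding determinantal_measure_def by (rule theI'[OF ex1_signed_measure_upsets])
  show "signed_measure (determinantal_measure K)" using * ..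
  show "determinantal_measure K {X. S \<subseteq> X} = principal_minor K S" using * by blast
qed

definition dpp_kernel :: "real^'n^'n \<Rightarrow> bool" where
  "dpp_kernel K \<longleftrightarrow>
     (\<forall>\<A>. 0 \<le> determinantal_measure K \<A>) \<and> determinantal_measure K UNIV = 1"

definition is_dpp :: "'a measure \<Rightarrow> ('a \<Rightarrow> 'n::finite set) \<Rightarrow> real^'n^'n \<Rightarrow> bool" where
  "is_dpp M X K \<longleftrightarrow>
     X \<in> measurable M (count_space UNIV) \<and> dpp_kernel K \<and>
     (\<forall>\<A>. measure M {\<omega> \<in> space M. X \<omega> \<in> \<A>} = determinantal_measure K \<A>)"

text \<open>
  Conditionally on the random vector \<open>B\<close>, \<open>X\<close> is a DPP with the random kernel \<open>L B\<close>.  This is meant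
  for \<open>B\<close> taking finitely many values only: conditioning on \<open>B\<close> is conditioning on each event
  \<open>B = b\<close> of positive probability, and \<^const>\<open>uniform_measure\<close> is the conditional probability given
  that event.
\<close>

definition cond_dpp ::
  "'a measure \<Rightarrow> ('a \<Rightarrow> 'n::finite set) \<Rightarrow> ('a \<Rightarrow> real^'n) \<Rightarrow> (real^'n \<Rightarrow> real^'n^'n) \<Rightarrow> bool" where
  "cond_dpp M X B L \<longleftrightarrow>
     X \<in> measurable M (count_space UNIV) \<and>
     (\<forall>b. measure M {\<omega> \<in> space M. B \<omega> = b} > 0 \<longrightarrow>
        is_dpp (uniform_measure M {\<omega> \<in> space M. B \<omega> = b}) X (L b))"

end

theory Submission
  imports Defs
begin

text \<open>
  Write \<open>K\<^sub>b = (I - P D(b) Q\<^sup>T) / 2\<close>.  Two facts carry the proof.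

  First, for fixed \<open>S\<close> the principal minor \<open>det ((K\<^sub>b)\<^sub>S)\<close> is affine in each coordinate of \<open>b\<close>
  separately: multiplying on the right by \<open>Q\<close> confines \<open>b\<^sub>i\<close> to a single column.  A function that is
  affine in each coordinate is determined by its values at the vertices of the cube \<open>{-1, 1}\<^sup>n\<close>, and
  the weights in this interpolation at a point \<open>x\<close>, products of \<open>(1 + x\<^sub>i) / 2\<close> and
  \<open>(1 - x\<^sub>i) / 2\<close>, are exactly the probabilities of the vertices for independent signs of mean
  \<open>x\<^sub>i\<close> (\<open>principal_minor_interpolation\<close>, \<open>prob_sign_vec\<close>).  Hence averaging the inclusion
  probabilities \<open>det ((K\<^sub>B)\<^sub>S)\<close> over \<open>B\<close> gives \<open>det (K\<^sub>S)\<close>, and inclusion probabilities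
  determine the law.

  Second, \<open>(I - M) / 2\<close> is a DPP kernel for every contraction \<open>M\<close>
  (\<open>dpp_kernel_of_contraction\<close>), in particular for the orthogonal matrices \<open>P D(b) Q\<^sup>T\<close> with
  \<open>b \<in> {-1, 1}\<^sup>n\<close>.  Here the mass of a single set \<open>X\<close> is \<open>2\<^sup>-\<^sup>n det (I + E M)\<close>, where \<open>E\<close> is
  diagonal with entry \<open>-1\<close> on \<open>X\<close> and \<open>1\<close> elsewhere.  For \<open>0 \<le> t < 1\<close> the matrix \<open>I + t E M\<close> is
  invertible, so its determinant keeps the sign that it has at \<open>t = 0\<close>; now let \<open>t\<close> tend to \<open>1\<close>.
\<close>

section \<open>Determinants and point masses\<close>

text \<open>
  Multilinearity in the rows, with all rows expanded at once.  Applied to the rows of a kernel it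
  gives the point masses of the determinantal measure; applied to a transposed matrix it gives the
  interpolation formula for principal minors.
\<close>

lemma det_row_expansion:
  fixes A C :: "'n::finite \<Rightarrow> 'n \<Rightarrow> real" and u v :: "'n \<Rightarrow> real"
  shows "det (\<chi> i j. u i * A i j + v i * C i j) =
    (\<Sum>T\<in>UNIV. prod u T * prod v (- T) * det (\<chi> i j. if i \<in> T then A i j else C i j))"
proof -
  have "(\<Prod>i\<in>UNIV. u i * A i (p i) + v i * C i (p i)) =
      (\<Sum>T\<in>UNIV. prod u T * prod v (- T) * (\<Prod>i\<in>UNIV. if i \<in> T then A i (p i) else C i (p i)))" for p
  proof -
    have "(\<Prod>i\<in>UNIV. if i \<in> T then A i (p i) else C i (p i)) =
        (\<Prod>i\<in>T. A i (p i)) * (\<Prod>i\<in>- T. C i (p i))" for T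
      by (subst prod.If_cases) (auto simp: Compl_eq_Diff_UNIV)
    then show ?thesis
      by (subst prod_add) (auto simp: prod.distrib Compl_eq_Diff_UNIV intro!: sum.cong)
  qed
  then have "det (\<chi> i j. u i * A i j + v i * C i j) =
      (\<Sum>p | p permutes UNIV. \<Sum>T\<in>UNIV. of_int (sign p) * (prod u T * prod v (- T) *
          (\<Prod>i\<in>UNIV. if i \<in> T then A i (p i) else C i (p i))))"
    by (simp add: det_def sum_distrib_left)
  also have "\<dots> = (\<Sum>T\<in>UNIV. \<Sum>p | p permutes UNIV. of_int (sign p) * (prod u T * prod v (- T) *
          (\<Prod>i\<in>UNIV. if i \<in> T then A i (p i) else C i (p i))))"
    by (rule sum.swap)
  finally show ?thesis
    by (simp add: det_def sum_distrib_left mult_ac)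
qed

text \<open>
  Turning principal minors into determinants of full size makes multilinearity and
  multiplicativity of \<^const>\<open>det\<close> available.  The identity rows outside \<open>S\<close> annihilate every
  permutation that moves a point outside \<open>S\<close>.
\<close>

lemma principal_minor_eq_det_rows:
  fixes K :: "real^'n^'n"
  shows "principal_minor K S = det (\<chi> i j. if i \<in> S then K $ i $ j else mat 1 $ i $ j)"
proof -
  let ?N = "\<lambda>i j. if i \<in> S then K $ i $ j else mat 1 $ i $ j"
  have "(\<Sum>p | p permutes UNIV. of_int (sign p) * (\<Prod>i\<in>UNIV. ?N i (p i))) =
      (\<Sum>p | p permutes S. of_int (sign p) * (\<Prod>i\<in>UNIV. ?N i (p i)))"
  proof (rule sum.mono_neutral_right)
    show "finite {p. p permutes (UNIV :: 'n set)}" by (simp add: finite_permutations)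
    show "{p. p permutes S} \<subseteq> {p. p permutes UNIV}"
      by (auto intro: permutes_subset)
    show "\<forall>p\<in>{p. p permutes UNIV} - {p. p permutes S}.
        of_int (sign p) * (\<Prod>i\<in>UNIV. ?N i (p i)) = 0"
    proof
      fix p assume p: "p \<in> {p. p permutes UNIV} - {p. p permutes S}"
      then obtain i where "i \<notin> S" "p i \<noteq> i"
        using permutes_superset[of p UNIV S] by auto
      then have "\<exists>i\<in>UNIV. ?N i (p i) = 0" by (intro bexI[of _ i]) (auto simp: mat_def)
      then have "(\<Prod>i\<in>UNIV. ?N i (p i)) = 0" by (intro prod_zero) simp_all
      then show "of_int (sign p) * (\<Prod>i\<in>UNIV. ?N i (p i)) = 0" by (simp only: mult_zero_right)
    qed
  qed
  also have "\<dots> = principal_minor K S"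
    unfolding principal_minor_def
  proof (intro sum.cong refl arg_cong2[where f = "(*)"])
    fix p assume "p \<in> {p. p permutes S}"
    then have "?N i (p i) = (if i \<in> S then K $ i $ p i else 1)" for i
      by (auto simp: mat_def permutes_not_in)
    then show "(\<Prod>i\<in>UNIV. ?N i (p i)) = (\<Prod>i\<in>S. K $ i $ p i)"
      by (simp add: prod.If_cases)
  qed
  finally show ?thesis by (simp add: det_def)
qed

lemma determinantal_measure_eqI:
  assumes "signed_measure \<mu>" and "\<And>S. \<mu> {X. S \<subseteq> X} = principal_minor K S"
  shows "determinantal_measure K = \<mu>"
  unfolding determinantal_measure_def
  using assms by (intro the1_equality[OF ex1_signed_measure_upsets]) auto

text \<open>
  Summing these determinants over \<open>X \<supseteq> S\<close> leaves the rows in \<open>S\<close> fixed and adds the two choices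
  for every other row, \<open>K + (I - K) = I\<close>, so the sum is the principal minor of \<open>S\<close>; the masses of
  the up-sets determine the measure.  This formula is what makes the sign of the point masses
  accessible.
\<close>

lemma determinantal_measure_eq_sum_det:
  fixes K :: "real^'n^'n"
  shows "determinantal_measure K \<A> =
    (\<Sum>X\<in>\<A>. det (\<chi> i j. if i \<in> X then K $ i $ j else (mat 1 - K) $ i $ j))"
proof -
  define m where "m = (\<lambda>X. det (\<chi> i j. if i \<in> X then K $ i $ j else (mat 1 - K) $ i $ j))"
  have "sum m {X. S \<subseteq> X} = principal_minor K S" for S
  proof -
    \<comment> \<open>The coefficient 0 on \<open>S\<close> kills exactly the terms with \<open>S \<not>\<subseteq> X\<close>.\<close>
    let ?v = "\<lambda>i. if i \<in> S then 0 else 1 :: real"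
    have v: "prod ?v (- X) = (if S \<subseteq> X then 1 else 0)" for X
      by (auto intro!: prod.neutral prod_zero)
    have "principal_minor K S = det (\<chi> i j. 1 * K $ i $ j + ?v i * (mat 1 - K) $ i $ j)"
      unfolding principal_minor_eq_det_rows
      by (intro arg_cong[where f = det]) (auto simp: vec_eq_iff)
    also have "\<dots> = (\<Sum>X\<in>UNIV. (if S \<subseteq> X then 1 else 0) * m X)"
      unfolding det_row_expansion[where u = "\<lambda>_. 1"] v m_def by simp
    also have "\<dots> = sum m {X. S \<subseteq> X}"
      by (simp add: if_distrib[of "\<lambda>x. x * _"] sum.If_cases cong: if_cong)
    finally show ?thesis by simp
  qed
  then have "determinantal_measure K = sum m"
    by (intro determinantal_measure_eqI signed_measure_sum)
  then show ?thesis by (simp only: m_def)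
qed

section \<open>Contractions give DPP kernels\<close>

text \<open>
  The determinant here is a point mass of the kernel \<open>(I - M) / 2\<close>.  Shrinking \<open>M\<close> to \<open>t M\<close> joins
  it to \<open>det (I / 2) > 0\<close>.  On the way it cannot vanish: a kernel vector \<open>x\<close> would satisfy
  \<open>x\<^sub>i = \<plusminus>t (M x)\<^sub>i\<close> for every \<open>i\<close>, hence \<open>\<parallel>x\<parallel> = t \<parallel>M x\<parallel> < \<parallel>x\<parallel>\<close>.
\<close>

lemma det_nonneg_of_contraction:
  fixes M :: "real^'n^'n"
  assumes contr: "\<And>x. norm (M *v x) \<le> norm x"
  shows "0 \<le> det (\<chi> i j. if i \<in> X then ((1/2) *\<^sub>R (mat 1 - M)) $ i $ j
                             else (mat 1 - (1/2) *\<^sub>R (mat 1 - M)) $ i $ j)"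
proof -
  define F :: "real \<Rightarrow> real^'n^'n" where
    "F t = (\<chi> i j. (mat 1 $ i $ j + (if i \<in> X then -1 else 1) * t * M $ i $ j) / 2)" for t
  have F1: "F 1 = (\<chi> i j. if i \<in> X then ((1/2) *\<^sub>R (mat 1 - M)) $ i $ j
                             else (mat 1 - (1/2) *\<^sub>R (mat 1 - M)) $ i $ j)"
    by (auto simp: F_def vec_eq_iff field_simps)
  have F0: "det (F 0) > 0"
  proof -
    have "det (F 0) = (\<Prod>i\<in>UNIV. F 0 $ i $ i)"
      by (rule det_diagonal) (simp add: F_def mat_def)
    then show ?thesis by (simp add: F_def mat_def prod_pos)
  qed
  have nz: "det (F t) \<noteq> 0" if t: "0 \<le> t" "t < 1" for t
  proof
    assume "det (F t) = 0"
    then obtain x where x: "x \<noteq> 0" "F t *v x = 0"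
      using matrix_left_invertible_ker[of "F t"] invertible_det_nz[of "F t"]
      by (auto simp: invertible_left_inverse)
    have row: "\<bar>x $ i\<bar> = \<bar>(t *\<^sub>R (M *v x)) $ i\<bar>" for i
    proof -
      have "0 = (F t *v x) $ i" using x by simp
      also have "\<dots> = (x $ i + (if i \<in> X then -1 else 1) * t * (M *v x) $ i) / 2"
      proof -
        have "(F t *v x) $ i = (\<Sum>j\<in>UNIV. (mat 1 $ i $ j * x $ j +
            (if i \<in> X then -1 else 1) * t * (M $ i $ j * x $ j)) / 2)"
          by (simp add: F_def matrix_vector_mult_def algebra_simps)
        also have "\<dots> = ((mat 1 *v x) $ i + (if i \<in> X then -1 else 1) * t * (M *v x) $ i) / 2"
          by (simp only: matrix_vector_mult_def vec_lambda_beta sum_distrib_left sum.distrib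
              sum_divide_distrib[symmetric])
        finally show ?thesis by simp
      qed
      finally show ?thesis by (auto split: if_splits)
    qed
    then have "norm x = norm (t *\<^sub>R (M *v x))"
      by (simp add: norm_vec_def L2_set_def del: vector_scaleR_component)
    also have "\<dots> \<le> t * norm x" using contr[of x] t by (simp add: mult_left_mono)
    also have "\<dots> < norm x" using x t by simp
    finally show False by simp
  qed
  have cont: "continuous_on UNIV (\<lambda>t. det (F t))"
    by (auto simp: det_def F_def intro!: continuous_intros)
  have pos: "det (F t) > 0" if t: "0 \<le> t" "t < 1" for t
  proof (rule ccontr)
    assume "\<not> det (F t) > 0"
    then obtain s where "0 \<le> s" "s \<le> t" "det (F s) = 0"
      using IVT2'[of "\<lambda>t. det (F t)" t 0 0] F0 t(1) continuous_on_subset[OF cont, of "{0..t}"] by auto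
    then show False using nz t by auto
  qed
  have "((\<lambda>t. det (F t)) \<longlongrightarrow> det (F 1)) (at_left 1)"
    using cont by (auto simp: continuous_on_eq_continuous_at isCont_def intro: tendsto_within_subset)
  moreover have "eventually (\<lambda>t. 0 \<le> det (F t)) (at_left 1)"
    by (rule eventually_mono[OF eventually_at_left_real[of 0]]) (auto intro!: less_imp_le pos)
  ultimately have "0 \<le> det (F 1)"
    by (rule tendsto_lowerbound) simp
  then show ?thesis by (simp only: F1)
qed

lemma dpp_kernel_of_contraction:
  fixes M :: "real^'n^'n"
  assumes "\<And>x. norm (M *v x) \<le> norm x"
  shows "dpp_kernel ((1/2) *\<^sub>R (mat 1 - M))"
  unfolding dpp_kernel_def
proof (intro conjI allI)
  show "0 \<le> determinantal_measure ((1/2) *\<^sub>R (mat 1 - M)) \<A>" for \<A>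
    unfolding determinantal_measure_eq_sum_det
    by (intro sum_nonneg det_nonneg_of_contraction assms)
  show "determinantal_measure ((1/2) *\<^sub>R (mat 1 - M)) UNIV = 1"
    using determinantal_measure(2)[of "(1/2) *\<^sub>R (mat 1 - M)" "{}"] by simp
qed

section \<open>Interpolation of principal minors\<close>

definition sign_vec :: "'n set \<Rightarrow> real^'n" where
  "sign_vec T = (\<chi> i. if i \<in> T then 1 else -1)"

lemma inj_sign_vec: "inj (sign_vec :: 'n::finite set \<Rightarrow> real^'n)"
proof (rule injI, rule set_eqI)
  fix T U :: "'n set" and i assume "sign_vec T = (sign_vec U :: real^'n)"
  then have "(sign_vec T :: real^'n) $ i = sign_vec U $ i" by simp
  then show "i \<in> T \<longleftrightarrow> i \<in> U" by (auto simp: sign_vec_def split: if_splits)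
qed

text \<open>
  Let \<open>J\<close> be diagonal with entries \<open>1/2\<close> on \<open>S\<close> and \<open>1\<close> elsewhere, and let \<open>1\<^sub>S\<close> be the diagonal
  indicator matrix of \<open>S\<close>.  Because \<open>Q Q\<^sup>T = I\<close>, the full-size matrix that computes the principal
  minor factors as \<open>(J Q - 1\<^sub>S P D(x) / 2) Q\<^sup>T\<close>, and in the first factor \<open>x\<^sub>i\<close> occurs only in column
  \<open>i\<close>, affinely.  So the principal minor is the multi-affine interpolation of its values at the
  vertices of the cube.
\<close>

lemma principal_minor_interpolation:
  fixes P Q :: "real^'n^'n"
  assumes Q: "orthogonal_matrix Q"
  shows "principal_minor ((1/2) *\<^sub>R (mat 1 - P ** diag_mat_of x ** transpose Q)) S =
    (\<Sum>T\<in>UNIV. (\<Prod>i\<in>T. (1 + x $ i) / 2) * (\<Prod>i\<in>- T. (1 - x $ i) / 2) *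
      principal_minor ((1/2) *\<^sub>R (mat 1 - P ** diag_mat_of (sign_vec T) ** transpose Q)) S)"
proof -
  \<comment> \<open>\<open>N y\<close> is the transpose of the first factor, so that rows can be expanded.\<close>
  define a where "a i k = (if k \<in> S then 1/2 else 1) * Q $ k $ i" for i k
  define c where "c i k = (if k \<in> S then - P $ k $ i / 2 else 0)" for i k
  define N where "N y = (\<chi> i k. a i k + y $ i * c i k)" for y :: "real^'n"
  have factor: "principal_minor ((1/2) *\<^sub>R (mat 1 - P ** diag_mat_of y ** transpose Q)) S
      = det (N y) * det Q" for y
  proof -
    have QQ: "(\<Sum>l\<in>UNIV. Q $ k $ l * Q $ j $ l) = mat 1 $ k $ j" for k j
      using Q by (simp add: orthogonal_matrix_def matrix_matrix_mult_def transpose_def vec_eq_iff)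
    have PD: "(P ** diag_mat_of y ** transpose Q) $ k $ j = (\<Sum>l\<in>UNIV. P $ k $ l * y $ l * Q $ j $ l)"
      for k j
      by (simp add: matrix_matrix_mult_def transpose_def diag_mat_of_def if_distrib cong: if_cong)
    have "(transpose (N y) ** transpose Q) $ k $ j =
        (if k \<in> S then ((1/2) *\<^sub>R (mat 1 - P ** diag_mat_of y ** transpose Q)) $ k $ j
         else mat 1 $ k $ j)" for k j
    proof -
      have "(transpose (N y) ** transpose Q) $ k $ j =
        (if k \<in> S then ((\<Sum>l\<in>UNIV. Q $ k $ l * Q $ j $ l)
             - (\<Sum>l\<in>UNIV. P $ k $ l * y $ l * Q $ j $ l)) / 2
         else (\<Sum>l\<in>UNIV. Q $ k $ l * Q $ j $ l))"
        by (simp add: matrix_matrix_mult_def transpose_def N_def a_def c_def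
            sum_subtractf[symmetric] sum_divide_distrib)
           (auto intro!: sum.cong simp: field_simps)
      then show ?thesis by (simp add: QQ PD)
    qed
    then have "transpose (N y) ** transpose Q =
        (\<chi> k j. if k \<in> S then ((1/2) *\<^sub>R (mat 1 - P ** diag_mat_of y ** transpose Q)) $ k $ j
         else mat 1 $ k $ j)"
      unfolding vec_eq_iff by simp
    then show ?thesis
      unfolding principal_minor_eq_det_rows by (metis det_mul det_transpose)
  qed
  \<comment> \<open>\<open>a + x c\<close> is the average of its values at \<open>x = 1\<close> and \<open>x = -1\<close> with weights \<open>(1 \<plusminus> x) / 2\<close>.\<close>
  have "N x = (\<chi> i k. (1 + x $ i) / 2 * (a i k + c i k) + (1 - x $ i) / 2 * (a i k - c i k))"
    by (simp add: N_def vec_eq_iff field_simps)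
  moreover have "N (sign_vec T) = (\<chi> i k. if i \<in> T then a i k + c i k else a i k - c i k)" for T
    by (simp add: N_def sign_vec_def vec_eq_iff)
  ultimately have "det (N x) = (\<Sum>T\<in>UNIV. (\<Prod>i\<in>T. (1 + x $ i) / 2) * (\<Prod>i\<in>- T. (1 - x $ i) / 2) *
      det (N (sign_vec T)))"
    by (simp only: det_row_expansion)
  then show ?thesis by (simp add: factor sum_distrib_right mult.assoc)
qed

section \<open>Independent random signs\<close>

text \<open>The mean determines the law of a sign, since \<open>Y = 2 \<cdot> 1\<^bsub>Y = 1\<^esub> - 1\<close>.\<close>

lemma (in prob_space) prob_sign_eq:
  fixes Y :: "'a \<Rightarrow> real"
  assumes Y: "random_variable borel Y" and pm: "\<And>\<omega>. \<omega> \<in> space M \<Longrightarrow> Y \<omega> \<in> {-1, 1}"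
  shows "prob (Y -` {1} \<inter> space M) = (1 + expectation Y) / 2"
    and "prob (Y -` {-1} \<inter> space M) = (1 - expectation Y) / 2"
proof -
  let ?A = "Y -` {1} \<inter> space M" and ?C = "Y -` {-1} \<inter> space M"
  have ev: "?A \<in> events" "?C \<in> events" using Y by (auto intro: measurable_sets)
  have "expectation Y = expectation (\<lambda>\<omega>. 2 * indicator ?A \<omega> - 1)"
    by (intro Bochner_Integration.integral_cong refl) (use pm in \<open>auto simp: indicator_def\<close>)
  also have "\<dots> = 2 * prob ?A - 1"
    using ev by (simp add: prob_space emeasure_eq_measure)
  finally show A: "prob ?A = (1 + expectation Y) / 2" by simp
  have "?C = space M - ?A" using pm by auto
  then show "prob ?C = (1 - expectation Y) / 2"
    using prob_compl[OF ev(1)] A by (simp add: field_simps)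
qed

lemma (in prob_space) prob_sign_vec:
  fixes B :: "'n::finite \<Rightarrow> 'a \<Rightarrow> real"
  assumes ind: "indep_vars (\<lambda>_. borel) B UNIV"
    and pm: "\<And>i \<omega>. \<omega> \<in> space M \<Longrightarrow> B i \<omega> \<in> {-1, 1}"
  shows "prob {\<omega> \<in> space M. (\<chi> i. B i \<omega>) = sign_vec T} =
    (\<Prod>i\<in>T. (1 + expectation (B i)) / 2) * (\<Prod>i\<in>- T. (1 - expectation (B i)) / 2)"
proof -
  have rv: "random_variable borel (B i)" for i
    using ind by (auto simp: indep_vars_def)
  define A where "A i = {sign_vec T $ i}" for i
  have "{\<omega> \<in> space M. (\<chi> i. B i \<omega>) = sign_vec T} = (\<Inter>i\<in>UNIV. B i -` A i \<inter> space M)"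
    by (auto simp: vec_eq_iff A_def)
  also have "prob \<dots> = (\<Prod>i\<in>UNIV. prob (B i -` A i \<inter> space M))"
    by (rule indep_varsD[OF ind]) (auto simp: A_def)
  also have "\<dots> = (\<Prod>i\<in>UNIV. if i \<in> T then (1 + expectation (B i)) / 2 else (1 - expectation (B i)) / 2)"
    using prob_sign_eq[OF rv pm] by (intro prod.cong refl) (auto simp: A_def sign_vec_def)
  finally show ?thesis by (simp add: prod.If_cases)
qed

section \<open>Mixing the DPPs\<close>

theorem proposition3p6:
  fixes M P Q :: "real^'n^'n"
    and \<sigma> :: "real^'n"
    and \<Omega> :: "'a measure"
    and B :: "'n \<Rightarrow> 'a \<Rightarrow> real"
    and K :: "real^'n^'n"
    and Kt :: "real^'n \<Rightarrow> real^'n^'n"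
  assumes "onorm ((*v) M) \<le> 1"
    and "orthogonal_matrix P" and "orthogonal_matrix Q"
    and "\<And>i. 0 \<le> \<sigma> $ i" and "\<And>i. \<sigma> $ i \<le> 1"
    and "M = P ** diag_mat_of \<sigma> ** transpose Q"
    and "prob_space \<Omega>"
    and "prob_space.indep_vars \<Omega> (\<lambda>_. borel) B UNIV"
    and "\<And>i \<omega>. \<omega> \<in> space \<Omega> \<Longrightarrow> B i \<omega> \<in> {-1, 1}"
    and "\<And>i. prob_space.expectation \<Omega> (B i) = \<sigma> $ i"
  defines "K \<equiv> (1/2) *\<^sub>R (mat 1 - M)"
    and "Kt \<equiv> (\<lambda>b. (1/2) *\<^sub>R (mat 1 - P ** diag_mat_of b ** transpose Q))"
  shows "(\<forall>\<omega>\<in>space \<Omega>. dpp_kernel (Kt (\<chi> i. B i \<omega>))) \<and>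
         (\<forall>X. cond_dpp \<Omega> X (\<lambda>\<omega>. \<chi> i. B i \<omega>) Kt \<longrightarrow> is_dpp \<Omega> X K)"
proof (intro conjI ballI allI impI)
  interpret prob_space \<Omega> by fact
  fix \<omega> assume \<omega>: "\<omega> \<in> space \<Omega>"
  \<comment> \<open>A diagonal matrix of signs is orthogonal, hence so is the whole product.\<close>
  have "B i \<omega> * B i \<omega> = 1" for i using assms(9)[OF \<omega>, of i] by auto
  then have "diag_mat_of (\<chi> i. B i \<omega>) ** diag_mat_of (\<chi> i. B i \<omega>) = mat 1"
    by (simp add: diag_mat_of_def matrix_matrix_mult_def mat_def vec_eq_iff mult_delta_left)
  moreover have "transpose (diag_mat_of (\<chi> i. B i \<omega>)) = diag_mat_of (\<chi> i. B i \<omega>)"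
    by (auto simp: diag_mat_of_def transpose_def vec_eq_iff)
  ultimately have "orthogonal_matrix (P ** diag_mat_of (\<chi> i. B i \<omega>) ** transpose Q)"
    using assms(2,3) by (intro orthogonal_matrix_mul) (simp_all add: orthogonal_matrix_def)
  then have "norm ((P ** diag_mat_of (\<chi> i. B i \<omega>) ** transpose Q) *v x) = norm x" for x
    by (simp add: orthogonal_transformation_matrix orthogonal_transformation_norm)
  then show "dpp_kernel (Kt (\<chi> i. B i \<omega>))"
    unfolding Kt_def by (intro dpp_kernel_of_contraction) simp
next
  interpret prob_space \<Omega> by fact
  fix X assume cond: "cond_dpp \<Omega> X (\<lambda>\<omega>. \<chi> i. B i \<omega>) Kt"
  then have X: "X \<in> measurable \<Omega> (count_space UNIV)" by (simp add: cond_dpp_def)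
  have evX: "{\<omega> \<in> space \<Omega>. X \<omega> \<in> \<A>} \<in> events" for \<A>
    using measurable_sets[OF X, of \<A>] by (simp add: vimage_def Int_def conj_commute)
  define E where "E T = {\<omega> \<in> space \<Omega>. (\<chi> i. B i \<omega>) = sign_vec T}" for T
  have evE: "E T \<in> events" for T
  proof -
    have "B i \<in> borel_measurable \<Omega>" for i using assms(8) by (auto simp: indep_vars_def)
    then have "(\<Inter>i\<in>UNIV. B i -` {sign_vec T $ i} \<inter> space \<Omega>) \<in> events"
      by (intro sets.finite_INT) auto
    also have "(\<Inter>i\<in>UNIV. B i -` {sign_vec T $ i} \<inter> space \<Omega>) = E T"
      by (auto simp: vec_eq_iff E_def)
    finally show ?thesis .
  qed
  have disj: "disjoint_family_on E UNIV"
    using inj_sign_vec by (fastforce simp: disjoint_family_on_def E_def dest: injD)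
  have cover: "(\<Union>T. E T) = space \<Omega>"
  proof -
    have "(\<chi> i. B i \<omega>) = sign_vec {i. B i \<omega> = 1}" if "\<omega> \<in> space \<Omega>" for \<omega>
      using assms(9)[OF that] by (auto simp: sign_vec_def vec_eq_iff)
    then show ?thesis by (auto simp: E_def)
  qed
  \<comment> \<open>Conditioning says nothing on vertices of probability zero; there both sides vanish.\<close>
  have cond_upset: "prob ({\<omega> \<in> space \<Omega>. S \<subseteq> X \<omega>} \<inter> E T) = prob (E T) * principal_minor (Kt (sign_vec T)) S"
    for S T
  proof (cases "prob (E T) = 0")
    case True
    then have "prob ({\<omega> \<in> space \<Omega>. S \<subseteq> X \<omega>} \<inter> E T) = 0"
      using finite_measure_mono[of "{\<omega> \<in> space \<Omega>. S \<subseteq> X \<omega>} \<inter> E T" "E T"] evE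
        measure_nonneg[of \<Omega> "{\<omega> \<in> space \<Omega>. S \<subseteq> X \<omega>} \<inter> E T"] by simp
    then show ?thesis using True by simp
  next
    case False
    then have pos: "prob (E T) > 0" by (simp add: zero_less_measure_iff)
    then have "is_dpp (uniform_measure \<Omega> (E T)) X (Kt (sign_vec T))"
      using cond by (simp add: cond_dpp_def E_def)
    then have "measure (uniform_measure \<Omega> (E T)) {\<omega> \<in> space \<Omega>. X \<omega> \<in> \<A>} =
        determinantal_measure (Kt (sign_vec T)) \<A>" for \<A>
      by (simp add: is_dpp_def)
    from this[of "{X. S \<subseteq> X}"]
    have "measure (uniform_measure \<Omega> (E T)) {\<omega> \<in> space \<Omega>. S \<subseteq> X \<omega>} =
        principal_minor (Kt (sign_vec T)) S"
      by (simp add: determinantal_measure(2))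
    then show ?thesis
      using pos evX[of "{X. S \<subseteq> X}"] evE[of T]
      by (subst (asm) measure_uniform_measure) (auto simp: emeasure_eq_measure field_simps Int_commute)
  qed
  have upset: "prob {\<omega> \<in> space \<Omega>. S \<subseteq> X \<omega>} = principal_minor K S" for S
  proof -
    let ?U = "{\<omega> \<in> space \<Omega>. S \<subseteq> X \<omega>}"
    have "?U = (\<Union>T\<in>UNIV. ?U \<inter> E T)" using cover by auto
    then have "prob ?U = prob (\<Union>T\<in>UNIV. ?U \<inter> E T)" by simp
    also have "\<dots> = (\<Sum>T\<in>UNIV. prob (?U \<inter> E T))"
      using evX[of "{X. S \<subseteq> X}"] evE disj
      by (intro finite_measure_finite_Union) (auto simp: disjoint_family_on_def)
    also have "\<dots> = (\<Sum>T\<in>UNIV. (\<Prod>i\<in>T. (1 + \<sigma> $ i) / 2) * (\<Prod>i\<in>- T. (1 - \<sigma> $ i) / 2) *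
        principal_minor (Kt (sign_vec T)) S)"
      unfolding cond_upset using prob_sign_vec[OF assms(8,9)] by (simp add: E_def assms(10))
    also have "\<dots> = principal_minor K S"
      unfolding K_def Kt_def assms(6) by (rule principal_minor_interpolation[OF assms(3), symmetric])
    finally show ?thesis .
  qed
  have "determinantal_measure K = (\<lambda>\<A>. prob {\<omega> \<in> space \<Omega>. X \<omega> \<in> \<A>})"
  proof (rule determinantal_measure_eqI)
    show "signed_measure (\<lambda>\<A>. prob {\<omega> \<in> space \<Omega>. X \<omega> \<in> \<A>})"
      unfolding signed_measure_def
    proof (intro conjI allI impI)
      fix \<A> \<B> :: "'n set set" assume "\<A> \<inter> \<B> = {}"
      moreover have "{\<omega> \<in> space \<Omega>. X \<omega> \<in> \<A> \<union> \<B>} =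
          {\<omega> \<in> space \<Omega>. X \<omega> \<in> \<A>} \<union> {\<omega> \<in> space \<Omega>. X \<omega> \<in> \<B>}" by auto
      ultimately show "prob {\<omega> \<in> space \<Omega>. X \<omega> \<in> \<A> \<union> \<B>} =
          prob {\<omega> \<in> space \<Omega>. X \<omega> \<in> \<A>} + prob {\<omega> \<in> space \<Omega>. X \<omega> \<in> \<B>}"
        using evX by (auto intro!: finite_measure_Union)
    qed simp
  qed (simp add: upset)
  moreover have "dpp_kernel K"
    unfolding K_def
  proof (rule dpp_kernel_of_contraction)
    fix x
    have "norm (M *v x) \<le> onorm ((*v) M) * norm x"
      by (rule onorm) (rule matrix_vector_mul_bounded_linear)
    also have "\<dots> \<le> norm x" using assms(1) mult_right_mono[of _ 1 "norm x"] by simp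
    finally show "norm (M *v x) \<le> norm x" .
  qed
  ultimately show "is_dpp \<Omega> X K" using X by (simp add: is_dpp_def)
qed

end
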